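(* For all integers $k\ge 2$, $c_{k,k}=1$ and $c_{k,2}=\binom{k}{2}$.
   Context: Let $H_{n,k}=\{0,1,\dots,n-1\}^k$. For $2\le\ell\le k$, an $\ell$-rook is a point $P\in H_{n,k}$ together with a set $D$ of $\ell$ of the $k$ coordinate indices; it covers $P$ itself and every point of $H_{n,k}$ which differs from $P$ in exactly one coordinate, that coordinate belonging to $D$. Distinct rooks must occupy distinct points. $c_{n,k,\ell}$ is the maximum number of $\ell$-rooks that can be placed in $H_{n,k}$ so that no point is covered by two different rooks, and $c_{k,\ell}=\lim_{n\to\infty} c_{n,k,\ell}/n^{k-2}$ (this limit exists). *)

theory Defs
  imports Complex_Main "HOL-Library.FuncSet" "HOL-Library.Disjoint_Sets"
begin

text \<open>Coordinates are indexed by \<open>0, \<dots>, k - 1\<close>; points are extensional functions, so that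
  equality of functions in the board is equality of points.\<close>

definition board :: "nat \<Rightarrow> nat \<Rightarrow> (nat \<Rightarrow> nat) set" where
  "board n k = ({..<k} \<rightarrow>\<^sub>E {..<n})"

type_synonym rook = "(nat \<Rightarrow> nat) \<times> nat set"

definition rooks :: "nat \<Rightarrow> nat \<Rightarrow> nat \<Rightarrow> rook set" where
  "rooks n k l = board n k \<times> {D. D \<subseteq> {..<k} \<and> card D = l}"

definition covered :: "nat \<Rightarrow> nat \<Rightarrow> rook \<Rightarrow> (nat \<Rightarrow> nat) set" where
  "covered n k = (\<lambda>(P, D). {Q \<in> board n k.
     Q = P \<or> (\<exists>i\<in>D. Q i \<noteq> P i \<and> (\<forall>j<k. j \<noteq> i \<longrightarrow> Q j = P j))})"

definition placement :: "nat \<Rightarrow> nat \<Rightarrow> nat \<Rightarrow> rook set \<Rightarrow> bool" where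
  "placement n k l R \<longleftrightarrow>
     R \<subseteq> rooks n k l \<and> inj_on fst R \<and> disjoint_family_on (covered n k) R"

definition rook_max :: "nat \<Rightarrow> nat \<Rightarrow> nat \<Rightarrow> nat" where
  "rook_max n k l = Max {card R |R. placement n k l R}"

text \<open>The maximum above is taken over a finite nonempty set.\<close>

lemma finite_rooks: "finite (rooks n k l)"
  by (auto simp: rooks_def board_def intro!: finite_cartesian_product finite_PiE)

lemma finite_placement_cards: "finite {card R |R. placement n k l R}"
proof -
  have "{card R |R. placement n k l R} \<subseteq> card ` Pow (rooks n k l)"
    by (auto simp: placement_def)
  then show ?thesis
    using finite_rooks by (meson finite_Pow_iff finite_imageI finite_subset)
qed

lemma placement_empty: "placement n k l {}"
  by (simp add: placement_def disjoint_family_on_def)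

definition rook_ratio :: "nat \<Rightarrow> nat \<Rightarrow> nat \<Rightarrow> real" where
  "rook_ratio k l n = real (rook_max n k l) / real n ^ (k - 2)"

definition rook_const :: "nat \<Rightarrow> nat \<Rightarrow> real" where
  "rook_const k l = lim (rook_ratio k l)"

end

theory Submission
  imports Defs "HOL-Number_Theory.Cong"
begin

text \<open>
  Two rooks are in conflict iff their points agree outside \<open>{i, j}\<close> for some direction \<open>i\<close> of the
  first and \<open>j\<close> of the second. Hence rooks sharing the two directions \<open>a, b\<close> are determined by
  their coordinates outside \<open>{a, b}\<close>, which gives both upper bounds.

  For \<open>l = k\<close> the placements are the codes of minimum distance 3. Let \<open>m \<le> n\<close> be the largest
  number congruent to 1 modulo \<open>k!\<close>. Since \<open>m\<close> is coprime to all differences of coordinate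
  indices, prescribing \<open>\<Sum>x\<^sub>i\<close> and \<open>\<Sum>i x\<^sub>i\<close> modulo \<open>m\<close> defines such a code in \<open>{0..<m}\<^sup>k\<close>, and by
  pigeonhole some choice of the two residues yields at least \<open>m\<^sup>k / m\<^sup>2\<close> points.

  For \<open>l = 2\<close> reserve one symbol for each pair \<open>D\<close> of directions. The rooks with direction set
  \<open>D\<close> have this symbol in both coordinates of \<open>D\<close> and arbitrary unreserved symbols elsewhere. Points
  belonging to different pairs \<open>D, E\<close> then differ on all of \<open>D \<union> E\<close>, so in at least 3 coordinates.
\<close>

section \<open>Conflicts between rooks\<close>

lemma covered_agree:
  assumes "X \<in> covered n k (P, D)" and "D \<noteq> {}"
  shows "\<exists>i\<in>D. \<forall>j<k. j \<noteq> i \<longrightarrow> X j = P j"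
  using assms by (auto simp: covered_def)

lemma covered_update:
  assumes "P \<in> board n k" "i \<in> D" "i < k" "v < n"
  shows "P(i := v) \<in> covered n k (P, D)"
proof -
  have "P(i := v) \<in> board n k"
    using assms by (auto simp: board_def PiE_iff extensional_def)
  moreover have "P(i := v) = P" if "v = P i"
    using that by simp
  ultimately show ?thesis
    using assms(2) by (cases "v = P i") (auto simp: covered_def)
qed

lemma board_eqI:
  assumes "P \<in> board n k" "Q \<in> board n k" "\<And>i. i < k \<Longrightarrow> P i = Q i"
  shows "P = Q"
  using assms unfolding board_def by (intro PiE_ext[of P "{..<k}" _ Q]) auto

text \<open>A point covered by two rooks differs from each rook's point in at most one of that
  rook's directions, so the two points agree off \<open>{i, j}\<close>. Since \<open>l > 0\<close>,
  each rook has a direction to serve as \<open>i\<close> or \<open>j\<close>, even where the covered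
  point is the rook itself. The case \<open>P = Q\<close> yields injectivity of
  \<open>fst\<close>.\<close>

lemma placementI:
  assumes R: "R \<subseteq> rooks n k l" and "l > 0"
    and eq: "\<And>P D Q E i j. \<lbrakk>(P, D) \<in> R; (Q, E) \<in> R; i \<in> D; j \<in> E;
      \<And>h. \<lbrakk>h < k; h \<noteq> i; h \<noteq> j\<rbrakk> \<Longrightarrow> P h = Q h\<rbrakk> \<Longrightarrow> (P, D) = (Q, E)"
  shows "placement n k l R"
proof -
  have ne: "D \<noteq> {}" if "(P, D) \<in> R" for P D
    using that R \<open>l > 0\<close> by (auto simp: rooks_def)
  have "(P, D) = (Q, E)" if PD: "(P, D) \<in> R" and QE: "(Q, E) \<in> R"
    and X: "X \<in> covered n k (P, D)" "X \<in> covered n k (Q, E)" for P D Q E X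
  proof -
    obtain i where i: "i \<in> D" "\<forall>h<k. h \<noteq> i \<longrightarrow> X h = P h"
      using covered_agree[OF X(1) ne[OF PD]] by blast
    obtain j where j: "j \<in> E" "\<forall>h<k. h \<noteq> j \<longrightarrow> X h = Q h"
      using covered_agree[OF X(2) ne[OF QE]] by blast
    show ?thesis
      using i j by (intro eq[OF PD QE, of i j]) metis+
  qed
  then have "disjoint_family_on (covered n k) R"
    unfolding disjoint_family_on_def by fastforce
  moreover have "inj_on fst R"
  proof (rule inj_onI)
    fix r s assume rs: "r \<in> R" "s \<in> R" "fst r = fst s"
    obtain P D E where "r = (P, D)" "s = (P, E)"
      using rs(3) by (metis prod.collapse)
    then show "r = s"
      using rs ne eq[of P D P E] by blast
  qed
  ultimately show ?thesis
    using R by (simp add: placement_def)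
qed

text \<open>Converse of the criterion above: moving \<open>P\<close> along \<open>i\<close> to the
  value \<open>Q i\<close> gives a point that \<open>Q\<close> reaches along \<open>j\<close>, so
  both rooks cover it.\<close>

lemma placement_agree_eq:
  assumes R: "placement n k l R" and PD: "(P, D) \<in> R" and QE: "(Q, E) \<in> R"
    and i: "i \<in> D" and j: "j \<in> E" and eq: "\<And>h. \<lbrakk>h < k; h \<noteq> i; h \<noteq> j\<rbrakk> \<Longrightarrow> P h = Q h"
  shows "(P, D) = (Q, E)"
proof (rule ccontr)
  assume "(P, D) \<noteq> (Q, E)"
  with R PD QE have disj: "covered n k (P, D) \<inter> covered n k (Q, E) = {}"
    by (auto simp: placement_def disjoint_family_on_def)
  have rk: "P \<in> board n k" "Q \<in> board n k" "i < k" "j < k"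
    using R PD QE i j by (auto simp: placement_def rooks_def)
  then have lt: "P j < n" "Q i < n"
    by (auto simp: board_def)
  \<comment> \<open>The value at \<open>j\<close> is \<open>P j\<close> if
    \<open>i \<noteq> j\<close> and \<open>Q i\<close> if \<open>i = j\<close>; this form treats
    both cases at once.\<close>
  have "P(i := Q i) = Q(j := (P(i := Q i)) j)"
    using rk eq lt by (intro board_eqI[of _ n k]) (auto simp: board_def PiE_iff extensional_def)
  moreover have "P(i := Q i) \<in> covered n k (P, D)"
    using rk lt i by (intro covered_update)
  moreover have "Q(j := (P(i := Q i)) j) \<in> covered n k (Q, E)"
    using rk lt j by (intro covered_update) auto
  ultimately show False
    using disj by auto
qed

section \<open>Upper bounds\<close>

text \<open>Forgetting coordinates \<open>a\<close> and \<open>b\<close> is injective on these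
  rooks: take direction \<open>a\<close> for one rook and \<open>b\<close> for the other.\<close>

lemma card_placement_common_directions_le:
  assumes R: "placement n k l R" and ab: "a < k" "b < k" "a \<noteq> b"
  shows "card {r \<in> R. a \<in> snd r \<and> b \<in> snd r} \<le> n ^ (k - 2)"
proof -
  let ?S = "{r \<in> R. a \<in> snd r \<and> b \<in> snd r}" and ?I = "{..<k} - {a, b}"
  let ?f = "\<lambda>r::rook. restrict (fst r) ?I"
  have "inj_on ?f ?S"
  proof (rule inj_onI)
    fix r s assume rs: "r \<in> ?S" "s \<in> ?S" "?f r = ?f s"
    obtain P D Q E where [simp]: "r = (P, D)" "s = (Q, E)"
      by (metis prod.collapse)
    have "P h = Q h" if "h < k" "h \<noteq> a" "h \<noteq> b" for h
      using rs(3) that by (auto dest: fun_cong[of _ _ h])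
    then show "r = s"
      using placement_agree_eq[OF R, of P D Q E a b] rs by auto
  qed
  moreover have "?f ` ?S \<subseteq> ?I \<rightarrow>\<^sub>E {..<n}"
  proof (rule image_subsetI)
    fix r assume "r \<in> ?S"
    then have "fst r \<in> board n k"
      using R by (auto simp: placement_def rooks_def)
    then show "?f r \<in> ?I \<rightarrow>\<^sub>E {..<n}"
      by (auto simp: board_def)
  qed
  ultimately have "card ?S \<le> card (?I \<rightarrow>\<^sub>E {..<n})"
    by (intro card_inj_on_le[of ?f]) (auto intro!: finite_PiE)
  also have "\<dots> = n ^ (k - 2)"
    using ab by (simp add: card_PiE card_Diff_subset numeral_2_eq_2)
  finally show ?thesis .
qed

lemma card_placement_le_rook_max: "placement n k l R \<Longrightarrow> card R \<le> rook_max n k l"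
  unfolding rook_max_def by (rule Max_ge[OF finite_placement_cards]) auto

lemma rook_max_le:
  assumes "\<And>R. placement n k l R \<Longrightarrow> card R \<le> B"
  shows "rook_max n k l \<le> B"
  unfolding rook_max_def using assms placement_empty[of n k l]
  by (subst Max_le_iff[OF finite_placement_cards]) auto

lemma rook_max_full_le:
  assumes "k \<ge> 2"
  shows "rook_max n k k \<le> n ^ (k - 2)"
proof (rule rook_max_le)
  fix R assume R: "placement n k k R"
  have "0 \<in> snd r \<and> 1 \<in> snd r" if "r \<in> R" for r
  proof -
    have "r \<in> rooks n k k"
      using that R by (auto simp: placement_def)
    then have "snd r = {..<k}"
      using card_subset_eq[of "{..<k}" "snd r"] by (simp add: rooks_def mem_Times_iff)
    then show ?thesis
      using assms by simp
  qed
  then have "{r \<in> R. 0 \<in> snd r \<and> 1 \<in> snd r} = R"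
    by blast
  then show "card R \<le> n ^ (k - 2)"
    using card_placement_common_directions_le[OF R, of 0 1] assms by simp
qed

lemma rook_max_2_le: "rook_max n k 2 \<le> (k choose 2) * n ^ (k - 2)"
proof (rule rook_max_le)
  fix R assume R: "placement n k 2 R"
  let ?D = "{D. D \<subseteq> {..<k} \<and> card D = 2}"
  let ?S = "\<lambda>D. {r \<in> R. D \<subseteq> snd r}"
  have fin: "finite R"
    using R finite_subset[OF _ finite_rooks] by (auto simp: placement_def)
  have "R \<subseteq> (\<Union>D\<in>?D. ?S D)"
  proof
    fix r assume "r \<in> R"
    moreover from this have "r \<in> rooks n k 2"
      using R by (auto simp: placement_def)
    then have "snd r \<in> ?D"
      by (simp add: rooks_def mem_Times_iff)
    ultimately show "r \<in> (\<Union>D\<in>?D. ?S D)"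
      by blast
  qed
  then have "card R \<le> card (\<Union>D\<in>?D. ?S D)"
    using fin by (intro card_mono) auto
  also have "\<dots> \<le> (\<Sum>D\<in>?D. card (?S D))"
    by (rule card_UN_le) simp
  also have "\<dots> \<le> (\<Sum>D\<in>?D. n ^ (k - 2))"
  proof (rule sum_mono)
    fix D assume "D \<in> ?D"
    then obtain a b where "D = {a, b}" "a \<noteq> b" "a < k" "b < k"
      by (auto simp: card_2_iff)
    then show "card (?S D) \<le> n ^ (k - 2)"
      using card_placement_common_directions_le[OF R, of a b] by simp
  qed
  also have "\<dots> = (k choose 2) * n ^ (k - 2)"
    by (simp add: n_subsets)
  finally show "card R \<le> (k choose 2) * n ^ (k - 2)" .
qed

section \<open>Lower bounds\<close>

lemma board_mono: "m \<le> n \<Longrightarrow> board m k \<subseteq> board n k"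
  unfolding board_def by (intro PiE_mono) auto

section \<open>Codes of minimum distance 3 from two checksums\<close>

lemma sum_lessThan_split2:
  fixes f :: "nat \<Rightarrow> 'a::comm_monoid_add"
  assumes "i < k" "j < k" "i \<noteq> j"
  shows "(\<Sum>h<k. f h) = f i + f j + (\<Sum>h\<in>{..<k} - {i, j}. f h)"
proof -
  have "(\<Sum>h<k. f h) = (\<Sum>h\<in>{i, j}. f h) + (\<Sum>h\<in>{..<k} - {i, j}. f h)"
    using assms by (subst sum.subset_diff[of "{i, j}"]) (auto simp: add.commute)
  then show ?thesis
    using assms by (simp add: add.assoc)
qed

text \<open>With \<open>d\<close> the difference of \<open>x\<close> and \<open>y\<close>, the
  checksums give \<open>d i + d j = 0\<close> and \<open>i * d i + j * d j = 0\<close> modulo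
  \<open>m\<close>. Eliminating \<open>d j\<close> leaves \<open>(i - j) * d i = 0\<close>, and
  \<open>i - j\<close> is a unit modulo \<open>m\<close>. As the coordinates are below
  \<open>m\<close>, congruence is equality.\<close>

lemma checksum_code_distance:
  assumes x: "x \<in> board m k" and y: "y \<in> board m k" and cop: "coprime (fact k) m"
    and s0: "[(\<Sum>h<k. x h) = (\<Sum>h<k. y h)] (mod m)"
    and s1: "[(\<Sum>h<k. h * x h) = (\<Sum>h<k. h * y h)] (mod m)"
    and ij: "i < k" "j < k" "i \<noteq> j"
    and eq: "\<And>h. \<lbrakk>h < k; h \<noteq> i; h \<noteq> j\<rbrakk> \<Longrightarrow> x h = y h"
  shows "x i = y i"
proof -
  let ?d = "\<lambda>h. int (x h) - int (y h)"
  have rest: "(\<Sum>h\<in>{..<k} - {i, j}. x h) = (\<Sum>h\<in>{..<k} - {i, j}. y h)"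
    "(\<Sum>h\<in>{..<k} - {i, j}. h * x h) = (\<Sum>h\<in>{..<k} - {i, j}. h * y h)"
    using eq by (auto intro!: sum.cong)
  have "[x i + x j = y i + y j] (mod m)"
    using s0 unfolding sum_lessThan_split2[OF ij] rest by (simp add: cong_add_rcancel_nat)
  then have d0: "int m dvd ?d i + ?d j"
    by (simp add: cong_iff_dvd_diff algebra_simps flip: cong_int_iff)
  have "[i * x i + j * x j = i * y i + j * y j] (mod m)"
    using s1 unfolding sum_lessThan_split2[OF ij] rest by (simp add: cong_add_rcancel_nat)
  then have d1: "int m dvd int i * ?d i + int j * ?d j"
    by (simp add: cong_iff_dvd_diff algebra_simps flip: cong_int_iff)
  have "int m dvd (int i * ?d i + int j * ?d j) - int j * (?d i + ?d j)"
    using d0 d1 by (intro dvd_diff dvd_mult)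
  also have "\<dots> = (int i - int j) * ?d i"
    by (simp add: algebra_simps)
  finally have dvd: "int m dvd (int i - int j) * ?d i" .
  have "nat \<bar>int i - int j\<bar> dvd fact k"
    using ij by (intro dvd_fact) auto
  then have "coprime (nat \<bar>int i - int j\<bar>) m"
    by (rule coprime_divisors[OF _ dvd_refl cop])
  then have "coprime (int m) (int i - int j)"
    by (simp add: coprime_commute flip: coprime_int_iff)
  then have "int m dvd ?d i"
    using dvd by (simp add: coprime_dvd_mult_right_iff)
  then have "[x i = y i] (mod m)"
    by (simp add: cong_iff_dvd_diff flip: cong_int_iff)
  moreover have "x i < m" "y i < m"
    using x y ij by (auto simp: board_def)
  ultimately show ?thesis
    by (simp add: cong_def)
qed

lemma rook_max_full_ge_coprime:
  assumes "k \<ge> 2" and cop: "coprime (fact k) m" and m: "0 < m" "m \<le> n"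
  shows "m ^ (k - 2) \<le> rook_max n k k"
proof -
  let ?f = "\<lambda>x. ((\<Sum>h<k. x h) mod m, (\<Sum>h<k. h * x h) mod m)"
  let ?B = "{..<m} \<times> {..<m}"
  have "finite (board m k)"
    by (auto simp: board_def intro!: finite_PiE)
  then obtain b where b: "card (board m k) \<le> card (?f -` {b} \<inter> board m k) * card ?B"
    using pigeonhole_card[of ?f "board m k" ?B] m by auto
  define C where "C = ?f -` {b} \<inter> board m k"
  have "m ^ (k - 2) * (m * m) = m ^ k"
    using assms(1) by (metis le_add_diff_inverse2 power2_eq_square power_add)
  also have "\<dots> \<le> card C * (m * m)"
    using b by (simp add: C_def board_def card_PiE card_cartesian_product)
  finally have "m ^ (k - 2) \<le> card C"
    using m by simp
  also have "card C = card ((\<lambda>x. (x, {..<k})) ` C)"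
    by (simp add: card_image inj_on_def)
  also have "\<dots> \<le> rook_max n k k"
  proof (rule card_placement_le_rook_max, rule placementI)
    show "(\<lambda>x. (x, {..<k})) ` C \<subseteq> rooks n k k"
      using board_mono[OF m(2), of k] by (auto simp: C_def rooks_def)
  next
    fix P D Q E i j
    assume P: "(P, D) \<in> (\<lambda>x. (x, {..<k})) ` C" and Q: "(Q, E) \<in> (\<lambda>x. (x, {..<k})) ` C"
      and i: "i \<in> D" and j: "j \<in> E"
      and eq: "\<And>h. \<lbrakk>h < k; h \<noteq> i; h \<noteq> j\<rbrakk> \<Longrightarrow> P h = Q h"
    have DE: "D = {..<k}" "E = {..<k}" and PQ: "P \<in> board m k" "Q \<in> board m k"
      and f: "?f P = ?f Q"
      using P Q by (auto simp: C_def)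
    \<comment> \<open>The distance lemma needs two distinct indices. If \<open>i = j\<close>, any
      other index serves as the second; one exists since \<open>k \<ge> 2\<close>.\<close>
    have "\<exists>j'<k. i \<noteq> j' \<and> (\<forall>h<k. h \<noteq> i \<longrightarrow> h \<noteq> j' \<longrightarrow> P h = Q h)"
    proof (cases "i = j")
      case True
      have "(if i = 0 then 1 else 0) < k \<and> i \<noteq> (if i = 0 then 1 else 0)"
        using \<open>k \<ge> 2\<close> by auto
      then show ?thesis
        using True eq by blast
    next
      case False
      then show ?thesis
        using j DE eq by auto
    qed
    then obtain j' where j': "j' < k" "i \<noteq> j'"
      "\<And>h. \<lbrakk>h < k; h \<noteq> i; h \<noteq> j'\<rbrakk> \<Longrightarrow> P h = Q h"
      by blast
    have ik: "i < k"
      using i DE by simp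
    have s: "[(\<Sum>h<k. P h) = (\<Sum>h<k. Q h)] (mod m)"
      "[(\<Sum>h<k. h * P h) = (\<Sum>h<k. h * Q h)] (mod m)"
      using f by (auto simp: cong_def)
    have "P i = Q i"
      using checksum_code_distance[OF PQ cop s ik j'] by blast
    moreover have "P j' = Q j'"
      using checksum_code_distance[OF PQ cop s j'(1) ik j'(2)[symmetric]] j'(3) by blast
    ultimately have "P = Q"
      using j'(3) by (intro board_eqI[OF PQ]) blast
    then show "(P, D) = (Q, E)"
      using DE by simp
  qed (use assms in auto)
  finally show ?thesis .
qed

lemma rook_max_full_ge:
  assumes "k \<ge> 2" "n > fact k"
  shows "(n - fact k) ^ (k - 2) \<le> rook_max n k k"
proof -
  \<comment> \<open>Rounding down \<open>n - 1\<close> rather than \<open>n\<close> keeps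
    \<open>m \<le> n\<close> after adding 1; the remainder lost is less than
    \<open>fact k\<close>.\<close>
  define m where "m = (n - 1) div fact k * fact k + 1"
  have "(n - 1) div fact k * fact k + (n - 1) mod fact k = n - 1"
    by (rule div_mult_mod_eq)
  moreover have "(n - 1) mod fact k < fact k"
    by simp
  ultimately have m: "0 < m" "m \<le> n" "n - fact k \<le> m"
    using assms unfolding m_def by linarith+
  have "coprime (fact k) m"
    unfolding m_def by (metis coprime_1_right coprime_iff_gcd_eq_1 gcd_add_mult mult.commute add.commute)
  then have "m ^ (k - 2) \<le> rook_max n k k"
    using rook_max_full_ge_coprime assms m by blast
  then show ?thesis
    using power_mono[OF m(3)] order_trans by blast
qed

section \<open>Rooks with two directions from reserved symbols\<close>

lemma rook_max_2_ge:
  assumes "n > k choose 2"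
  shows "(k choose 2) * (n - (k choose 2)) ^ (k - 2) \<le> rook_max n k 2"
proof -
  let ?c = "k choose 2" and ?Ds = "{D. D \<subseteq> {..<k} \<and> card D = 2}"
  have fin: "finite ?Ds" and "card ?Ds = ?c"
    by (simp_all add: n_subsets)
  then obtain s where "bij_betw s ?Ds {0..<?c}"
    using ex_bij_betw_finite_nat by metis
  then have s_inj: "inj_on s ?Ds" and s_less: "\<And>D. D \<in> ?Ds \<Longrightarrow> s D < ?c"
    by (auto simp: bij_betw_def)
  \<comment> \<open>The symbols below \<open>?c\<close> are the reserved ones, with
    \<open>s D\<close> belonging to \<open>D\<close>.\<close>
  define X where "X D = (\<Pi>\<^sub>E i\<in>{..<k}. if i \<in> D then {s D} else {?c..<n})" for D
  have X_in: "x i = s D" if "x \<in> X D" "i \<in> D" "D \<in> ?Ds" for x i D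
    using that by (auto simp: X_def PiE_iff split: if_splits)
  have X_out: "?c \<le> x i" if "x \<in> X D" "i < k" "i \<notin> D" for x i D
    using that by (auto simp: X_def PiE_iff split: if_splits)
  have X_board: "X D \<subseteq> board n k" if "D \<in> ?Ds" for D
    using s_less[OF that] assms unfolding X_def board_def by (intro PiE_mono) auto
  define R where "R = (SIGMA D:?Ds. X D)"
  have "card (X D) = (n - ?c) ^ (k - 2)" if "D \<in> ?Ds" for D
  proof -
    have "card (X D) = (\<Prod>i<k. if i \<in> D then 1 else n - ?c)"
      by (auto simp: X_def card_PiE intro!: prod.cong)
    also have "\<dots> = (n - ?c) ^ card ({..<k} - D)"
      by (simp add: prod.If_cases Diff_eq)
    also have "card ({..<k} - D) = k - 2"
      using that by (auto simp: card_Diff_subset finite_subset)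
    finally show ?thesis .
  qed
  moreover have "finite (X D)" for D
    by (auto simp: X_def intro!: finite_PiE)
  ultimately have "?c * (n - ?c) ^ (k - 2) = card R"
    using fin \<open>card ?Ds = ?c\<close> by (simp add: R_def)
  also have "card R = card (prod.swap ` R)"
    by (simp add: card_image)
  also have "\<dots> \<le> rook_max n k 2"
  proof (rule card_placement_le_rook_max, rule placementI)
    show "prod.swap ` R \<subseteq> rooks n k 2"
    proof
      fix r assume "r \<in> prod.swap ` R"
      then obtain D x where r: "r = (x, D)" "D \<in> ?Ds" "x \<in> X D"
        unfolding R_def by auto
      then show "r \<in> rooks n k 2"
        using X_board[OF r(2)] by (auto simp: rooks_def)
    qed
  next
    fix P D Q E i j
    assume P: "(P, D) \<in> prod.swap ` R" and Q: "(Q, E) \<in> prod.swap ` R"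
      and i: "i \<in> D" and j: "j \<in> E"
      and eq: "\<And>h. \<lbrakk>h < k; h \<noteq> i; h \<noteq> j\<rbrakk> \<Longrightarrow> P h = Q h"
    have D: "D \<in> ?Ds" and E: "E \<in> ?Ds" and PD: "P \<in> X D" and QE: "Q \<in> X E"
      using P Q by (auto simp: R_def)
    have "D = E"
    proof (rule ccontr)
      assume "D \<noteq> E"
      then have "s D \<noteq> s E"
        using s_inj D E by (auto dest: inj_onD)
      \<comment> \<open>At \<open>h\<close>, two different reserved symbols meet, or a reserved and
        an unreserved one. So \<open>P\<close> and \<open>Q\<close> differ there, which is allowed
        only at \<open>i\<close> or \<open>j\<close>. Then two-element sets \<open>D\<close> and
        \<open>E\<close> both inside \<open>{i, j}\<close> must coincide.\<close>
      have "h \<in> {i, j}" if h: "h \<in> D \<union> E" for h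
      proof -
        have "h < k"
          using h D E by auto
        have "P h \<noteq> Q h"
        proof (cases "h \<in> D")
          case hD: True
          show ?thesis
          proof (cases "h \<in> E")
            case True
            then show ?thesis
              using X_in[OF PD hD D] X_in[OF QE _ E, of h] \<open>s D \<noteq> s E\<close> by simp
          next
            case False
            then show ?thesis
              using X_in[OF PD hD D] X_out[OF QE \<open>h < k\<close>] s_less[OF D] by linarith
          qed
        next
          case False
          then show ?thesis
            using X_out[OF PD \<open>h < k\<close>] X_in[OF QE _ E, of h] s_less[OF E] h by force
        qed
        then show ?thesis
          using eq[OF \<open>h < k\<close>] by blast
      qed
      then have "D \<union> E \<subseteq> {i, j}"
        by blast
      moreover have "card {i, j} \<le> card D" "card {i, j} \<le> card E"
        using D E by (auto simp: card_insert_if)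
      ultimately have "D = {i, j}" "E = {i, j}"
        by (simp_all add: card_seteq)
      then show False
        using \<open>D \<noteq> E\<close> by simp
    qed
    \<comment> \<open>Inside \<open>D\<close> both points carry \<open>s D\<close>; outside they
      agree because \<open>i\<close> and \<open>j\<close> lie in \<open>D = E\<close>.\<close>
    have "P h = Q h" if "h < k" for h
    proof (cases "h \<in> D")
      case True
      then show ?thesis
        using X_in[OF PD _ D, of h] X_in[OF QE _ E, of h] \<open>D = E\<close> by simp
    next
      case False
      then show ?thesis
        using eq[OF that] i j \<open>D = E\<close> by blast
    qed
    then have "P = Q"
      using X_board[OF D] X_board[OF E] PD QE by (intro board_eqI[of P n k Q]) auto
    with \<open>D = E\<close> show "(P, D) = (Q, E)"
      by simp
  qed simp
  finally show ?thesis .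
qed

section \<open>The limits\<close>

text \<open>Giving up a fixed number \<open>a\<close> of values per coordinate costs only the factor
  \<open>(1 - a / n) ^ (k - 2)\<close>, which tends to 1 for fixed \<open>k\<close>, so the two
  bounds squeeze the ratio.\<close>

lemma rook_const_eqI:
  assumes lower: "\<And>n. n > a \<Longrightarrow> c * (n - a) ^ (k - 2) \<le> rook_max n k l"
    and upper: "\<And>n. rook_max n k l \<le> c * n ^ (k - 2)"
  shows "convergent (rook_ratio k l) \<and> rook_const k l = real c"
proof -
  have "rook_ratio k l \<longlonglongrightarrow> real c"
  proof (rule tendsto_sandwich)
    show "\<forall>\<^sub>F n in sequentially. real c * (1 - real a / real n) ^ (k - 2) \<le> rook_ratio k l n"
      using eventually_gt_at_top[of a]
    proof eventually_elim
      case (elim n)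
      have "1 - real a / real n = real (n - a) / real n"
        using elim by (simp add: diff_divide_distrib)
      then have "real c * (1 - real a / real n) ^ (k - 2) =
          real (c * (n - a) ^ (k - 2)) / real n ^ (k - 2)"
        by (simp add: power_divide)
      also have "\<dots> \<le> rook_ratio k l n"
        unfolding rook_ratio_def using lower[OF elim] by (intro divide_right_mono of_nat_mono) auto
      finally show ?case .
    qed
    show "\<forall>\<^sub>F n in sequentially. rook_ratio k l n \<le> real c"
      using eventually_gt_at_top[of 0]
    proof eventually_elim
      case (elim n)
      have "real (rook_max n k l) \<le> real c * real n ^ (k - 2)"
        using upper[of n] by (simp flip: of_nat_power of_nat_mult)
      then show ?case
        using elim by (simp add: rook_ratio_def divide_le_eq)
    qed
    have "(\<lambda>n. real a / real n) \<longlonglongrightarrow> 0"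
      by (rule lim_const_over_n)
    then show "(\<lambda>n. real c * (1 - real a / real n) ^ (k - 2)) \<longlonglongrightarrow> real c"
      by (auto intro!: tendsto_eq_intros)
  qed simp
  then show ?thesis
    by (auto simp: rook_const_def convergent_def limI)
qed

theorem theorem21:
  fixes k :: nat
  assumes "k \<ge> 2"
  shows "(convergent (rook_ratio k k) \<and> rook_const k k = 1) \<and>
         (convergent (rook_ratio k 2) \<and> rook_const k 2 = real (k choose 2))"
proof
  show "convergent (rook_ratio k k) \<and> rook_const k k = 1"
    using rook_const_eqI[of "fact k" 1 k k] rook_max_full_ge rook_max_full_le assms by simp
  show "convergent (rook_ratio k 2) \<and> rook_const k 2 = real (k choose 2)"
    \<comment> \<open>Here \<open>k choose 2\<close> is both the number of reserved symbols and the
      leading coefficient.\<close>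
    using rook_const_eqI[of "k choose 2" "k choose 2" k 2] rook_max_2_ge rook_max_2_le by simp
qed

end
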